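(* Let $X=\mathcal{X}_e(m,n;r,t)$, where $m,n\ge 4$ are even integers and $r\in\mathbb{Z}_n^*$, $t\in\mathbb{Z}_n$ are such that $r^m=1$, $t(r-1)=0$ and $1+r+\cdots+r^{m-1}+2t=0$. Suppose $X$ is half-arc-transitive. Then $X\cong\mathcal{X}_e(m',n';r',t')$ (where $m',n'\geq 4$ are even and $r'\in\mathbb{Z}_{n'}^*$, $t'\in\mathbb{Z}_{n'}$ satisfy the analogous conditions) if and only if $m'=m$, $n'=n$ and one of the following holds: (i) $r'=r$ and $t'=t$; (ii) $r'=-r$ and $t'=t+r+r^3+\cdots+r^{m-1}$; (iii) $r'=r^{-1}$ and $t'=t$; (iv) $r'=-r^{-1}$ and $t'=t+r+r^3+\cdots+r^{m-1}$.
   Context: A graph is half-arc-transitive if its automorphism group acts transitively on vertices and on edges but not on arcs (ordered pairs of adjacent vertices). $\mathbb{Z}_n$ is the ring of residue classes modulo $n$, and $\mathbb{Z}_n^*$ its set of invertible elements. For even integers $m,n\ge 4$ and $r\in\mathbb{Z}_n^*$, $t\in\mathbb{Z}_n$ satisfying $r^m=1$, $t(r-1)=0$ and $1+r+\cdots+r^{m-1}+2t=0$ in $\mathbb{Z}_n$, the graph $\mathcal{X}_e(m,n;r,t)$ has vertex set $\{u_i^j : i\in\mathbb{Z}_m, j\in\mathbb{Z}_n\}$ and edges given by: $u_i^j\sim u_{i+1}^j,\ u_{i+1}^{j+r^i}$ for $i\in\mathbb{Z}_m\setminus\{m-1\}$, $j\in\mathbb{Z}_n$; and $u_{m-1}^j\sim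 u_0^{j+t},\ u_0^{j+r^{m-1}+t}$ for $j\in\mathbb{Z}_n$. *)

theory Defs
  imports "HOL-Number_Theory.Number_Theory"
begin

section \<open>Undirected graphs and their symmetries\<close>

record 'a ugraph =
  verts :: "'a set"
  edges :: "'a set set"

definition simple_graph :: "'a ugraph \<Rightarrow> bool" where
  "simple_graph G \<longleftrightarrow> (\<forall>e \<in> edges G. e \<subseteq> verts G \<and> card e = 2)"

definition graph_isomorphism :: "'a ugraph \<Rightarrow> 'b ugraph \<Rightarrow> ('a \<Rightarrow> 'b) \<Rightarrow> bool" where
  "graph_isomorphism G H f \<longleftrightarrow>
     bij_betw f (verts G) (verts H) \<and>
     (\<forall>u \<in> verts G. \<forall>v \<in> verts G. {u, v} \<in> edges G \<longleftrightarrow> {f u, f v} \<in> edges H)"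

definition graph_isomorphic :: "'a ugraph \<Rightarrow> 'b ugraph \<Rightarrow> bool" (infix \<open>\<simeq>\<^sub>G\<close> 50) where
  "G \<simeq>\<^sub>G H \<longleftrightarrow> (\<exists>f. graph_isomorphism G H f)"

abbreviation graph_automorphism :: "'a ugraph \<Rightarrow> ('a \<Rightarrow> 'a) \<Rightarrow> bool" where
  "graph_automorphism G \<equiv> graph_isomorphism G G"

definition arcs :: "'a ugraph \<Rightarrow> ('a \<times> 'a) set" where
  "arcs G = {(u, v). u \<in> verts G \<and> v \<in> verts G \<and> {u, v} \<in> edges G}"

definition vertex_transitive :: "'a ugraph \<Rightarrow> bool" where
  "vertex_transitive G \<longleftrightarrow>
     (\<forall>u \<in> verts G. \<forall>v \<in> verts G. \<exists>f. graph_automorphism G f \<and> f u = v)"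

definition edge_transitive :: "'a ugraph \<Rightarrow> bool" where
  "edge_transitive G \<longleftrightarrow>
     (\<forall>d \<in> edges G. \<forall>e \<in> edges G. \<exists>f. graph_automorphism G f \<and> f ` d = e)"

definition arc_transitive :: "'a ugraph \<Rightarrow> bool" where
  "arc_transitive G \<longleftrightarrow>
     (\<forall>a \<in> arcs G. \<forall>b \<in> arcs G. \<exists>f. graph_automorphism G f \<and> map_prod f f a = b)"

definition half_arc_transitive :: "'a ugraph \<Rightarrow> bool" where
  "half_arc_transitive G \<longleftrightarrow>
     vertex_transitive G \<and> edge_transitive G \<and> \<not> arc_transitive G"


section \<open>The graphs \<open>X\<^sub>e(m,n;r,t)\<close>\<close>

text \<open>
  Elements \<open>r\<close>, \<open>t\<close> of the ring of residue classes modulo \<open>n\<close> are given by arbitrary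
  integer representatives, and equations in that ring are congruences modulo \<open>n\<close>. The
  vertex \<open>u\<^sub>i\<^sup>j\<close> is the pair \<open>(i, j)\<close> with \<open>i\<close>, \<open>j\<close> the least nonnegative
  representatives of its indices. Lemma \<open>Xe_cong\<close> below shows that the graph depends on
  \<open>r\<close> and \<open>t\<close> only through their residue classes.
\<close>

definition Xe_params :: "nat \<Rightarrow> nat \<Rightarrow> int \<Rightarrow> int \<Rightarrow> bool" where
  "Xe_params m n r t \<longleftrightarrow>
     even m \<and> 4 \<le> m \<and> even n \<and> 4 \<le> n \<and>
     coprime r (int n) \<and>
     [r ^ m = 1] (mod int n) \<and>
     [t * (r - 1) = 0] (mod int n) \<and>
     [(\<Sum>i<m. r ^ i) + 2 * t = 0] (mod int n)"

definition Xe :: "nat \<Rightarrow> nat \<Rightarrow> int \<Rightarrow> int \<Rightarrow> (nat \<times> int) ugraph" where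
  "Xe m n r t = \<lparr>
     verts = {0..<m} \<times> {0..<int n},
     edges =
       {{(i, j), (i + 1, j)} | i j. i < m - 1 \<and> j \<in> {0..<int n}} \<union>
       {{(i, j), (i + 1, (j + r ^ i) mod int n)} | i j. i < m - 1 \<and> j \<in> {0..<int n}} \<union>
       {{(m - 1, j), (0, (j + t) mod int n)} | j. j \<in> {0..<int n}} \<union>
       {{(m - 1, j), (0, (j + r ^ (m - 1) + t) mod int n)} | j. j \<in> {0..<int n}}\<rparr>"

lemma Xe_cong:
  assumes "[r = r'] (mod int n)" "[t = t'] (mod int n)"
  shows "Xe m n r t = Xe m n r' t'"
proof -
  have 1: "(j + r ^ i) mod int n = (j + r' ^ i) mod int n" for i j
    using cong_add[OF cong_refl[of j] cong_pow[OF assms(1), of i]] by (simp add: cong_def)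
  have 2: "(j + t) mod int n = (j + t') mod int n" for j
    using cong_add[OF cong_refl[of j] assms(2)] by (simp add: cong_def)
  have 3: "(j + r ^ i + t) mod int n = (j + r' ^ i + t') mod int n" for i j
    using cong_add[OF cong_add[OF cong_refl[of j] cong_pow[OF assms(1), of i]] assms(2)]
    by (simp add: cong_def)
  show ?thesis
    unfolding Xe_def 1 3 unfolding 2 ..
qed

lemma simple_graph_Xe:
  assumes "2 \<le> m" "0 < n"
  shows "simple_graph (Xe m n r t)"
  using assms by (auto simp: simple_graph_def Xe_def card_insert_if)

end

theory Submission
  imports Defs
begin

text \<open>
  Orient every edge from level \<open>i\<close> to level \<open>i + 1\<close>. Affine maps of the levels show that the automorphisms
  preserving this orientation are transitive on the directed edges (darts), so if the graph is not
  arc-transitive, then the darts form an orbit of its automorphism group, and every isomorphism onto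
  a graph of the same family preserves or reverses the orientation. Reversing the orientation of the target
  replaces \<open>r\<close> by its inverse and keeps \<open>t\<close>, so only orientation preserving isomorphisms remain.
  Two vertices of a level share an out-neighbour iff their indices differ by \<open>r\<^sup>i\<close>. Hence such an isomorphism
  maps level 0 affinely onto a level, and then level by level it is affine with the same slope up to
  sign, which gives \<open>r' = \<plusminus>r\<close>. Comparing both descriptions of level \<open>m\<close>, which is level 0 shifted by \<open>t\<close>,
  determines \<open>t'\<close>.
\<close>

section \<open>Graph isomorphisms and orbits of arcs\<close>

lemma graph_isomorphism_edges:
  assumes "graph_isomorphism G H f" "u \<in> verts G" "v \<in> verts G"
  shows "{f u, f v} \<in> edges H \<longleftrightarrow> {u, v} \<in> edges G"
  using assms by (auto simp: graph_isomorphism_def)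

lemma graph_isomorphism_in_verts:
  assumes "graph_isomorphism G H f" "v \<in> verts G"
  shows "f v \<in> verts H"
  using assms by (auto simp: graph_isomorphism_def bij_betw_def)

lemma graph_isomorphism_comp:
  assumes "graph_isomorphism G H f" "graph_isomorphism H K g"
  shows "graph_isomorphism G K (g \<circ> f)"
  using assms unfolding graph_isomorphism_def
  by (auto intro: bij_betw_trans dest: bij_betwE)

lemma graph_isomorphism_inv_into:
  assumes "graph_isomorphism G H f"
  shows "graph_isomorphism H G (inv_into (verts G) f)"
proof -
  let ?g = "inv_into (verts G) f"
  have f: "bij_betw f (verts G) (verts H)"
    using assms by (simp add: graph_isomorphism_def)
  have g: "bij_betw ?g (verts H) (verts G)"
    using f by (rule bij_betw_inv_into)
  have "{u, v} \<in> edges H \<longleftrightarrow> {?g u, ?g v} \<in> edges G" if "u \<in> verts H" "v \<in> verts H" for u v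
    using graph_isomorphism_edges[OF assms, of "?g u" "?g v"] that bij_betwE[OF g]
    by (simp add: bij_betw_inv_into_right[OF f])
  with g show ?thesis by (simp add: graph_isomorphism_def)
qed

lemma graph_isomorphic_trans:
  assumes "G \<simeq>\<^sub>G H" "H \<simeq>\<^sub>G K" shows "G \<simeq>\<^sub>G K"
  using assms graph_isomorphism_comp unfolding graph_isomorphic_def by blast

lemma graph_isomorphic_sym:
  assumes "G \<simeq>\<^sub>G H" shows "H \<simeq>\<^sub>G G"
  using assms graph_isomorphism_inv_into unfolding graph_isomorphic_def by blast

text \<open>Two arcs that are both images of \<open>(u, v)\<close>, under \<open>f\<close> and
  \<open>g\<close>, are related by \<open>g\<close> after the inverse of \<open>f\<close>. So it
  suffices to reach every arc from one fixed pair.\<close>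

lemma arc_transitive_if_orbit:
  assumes uv: "u \<in> verts G" "v \<in> verts G"
    and orbit: "\<And>x y. (x, y) \<in> arcs G \<Longrightarrow> \<exists>f. graph_automorphism G f \<and> f u = x \<and> f v = y"
  shows "arc_transitive G"
  unfolding arc_transitive_def
proof (intro ballI)
  fix a b assume "a \<in> arcs G" "b \<in> arcs G"
  then obtain f g where f: "graph_automorphism G f" "(f u, f v) = a"
    and g: "graph_automorphism G g" "(g u, g v) = b"
    using orbit[of "fst a" "snd a"] orbit[of "fst b" "snd b"] by auto
  let ?h = "inv_into (verts G) f"
  have "inj_on f (verts G)"
    using f by (simp add: graph_isomorphism_def bij_betw_def)
  then have "map_prod (g \<circ> ?h) (g \<circ> ?h) a = b"
    using uv f(2) g(2) by auto
  moreover have "graph_automorphism G (g \<circ> ?h)"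
    using f g graph_isomorphism_inv_into graph_isomorphism_comp by blast
  ultimately show "\<exists>f. graph_automorphism G f \<and> map_prod f f a = b" by blast
qed

section \<open>Congruences and inverses\<close>

lemma cong_lincomb1:
  fixes x y :: int
  assumes "[a = b] (mod n)" "x - y = u * (a - b)"
  shows "[x = y] (mod n)"
  using assms by (simp add: cong_iff_dvd_diff)

text \<open>Together with its variants for one and three congruences, this turns a derived
  congruence into an integer identity. The coefficients are supplied by hand, and
  \<open>algebra_simps\<close> checks the identity.\<close>

lemma cong_lincomb2:
  fixes x y :: int
  assumes "[a = b] (mod n)" "[c = d] (mod n)" "x - y = u * (a - b) + v * (c - d)"
  shows "[x = y] (mod n)"
  using assms by (simp add: cong_iff_dvd_diff)

lemma cong_lincomb3:
  fixes x y :: int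
  assumes "[a = b] (mod n)" "[c = d] (mod n)" "[e = f] (mod n)"
    "x - y = u * (a - b) + v * (c - d) + w * (e - f)"
  shows "[x = y] (mod n)"
  using assms by (simp add: cong_iff_dvd_diff)

lemma sum_even_odd:
  fixes f :: "nat \<Rightarrow> int"
  shows "(\<Sum>i<2 * k. f i) = (\<Sum>i<k. f (2 * i)) + (\<Sum>i<k. f (2 * i + 1))"
  by (induction k) (simp_all add: algebra_simps)

text \<open>The factor \<open>x\<close> is a sign, so a relation up to sign between two units passes
  to their inverses. It is used to exchange conditions on \<open>r'\<close> and on its
  inverse.\<close>

lemma cong_inverse_unique:
  fixes a a' b b' x n :: int
  assumes "[a * a' = 1] (mod n)" "[b * b' = 1] (mod n)" "[a = x * b] (mod n)" "x * x = 1"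
  shows "[a' = x * b'] (mod n)"
proof (rule cong_lincomb3[OF assms(1-3), of _ _ "x * b'" "- a'" "- x * b' * a'"])
  have "- x * b' * a' * (a - x * b) = - x * b' * a' * a + (x * x) * b' * a' * b"
    by (simp add: algebra_simps)
  then show "a' - x * b' = x * b' * (a * a' - 1) + - a' * (b * b' - 1) + - x * b' * a' * (a - x * b)"
    using assms(4) by (simp add: algebra_simps)
qed

section \<open>Levels, darts and edges of one graph\<close>

locale Xe_graph =
  fixes m n :: nat and r t :: int
  assumes m_pos: "0 < m"
    and n_ge: "3 \<le> n"
    and coprime_r: "coprime r (int n)"
    and r_pow_m: "[r ^ m = 1] (mod int n)"
    and tr: "[t * (r - 1) = 0] (mod int n)"
begin

text \<open>
  \<open>R k\<close> and \<open>pt k j\<close> extend \<open>r ^ k\<close> and the vertex \<open>u\<^sub>k\<^sup>j\<close> to all integers \<open>k\<close>, with \<open>u\<^sub>k\<^sub>+\<^sub>m\<^sup>j = u\<^sub>k\<^sup>j\<^sup>+\<^sup>t\<close>.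
  The edges that wrap around then need no special treatment.
\<close>

definition R :: "int \<Rightarrow> int" where
  "R k = r ^ nat (k mod int m)"

definition pt :: "int \<Rightarrow> int \<Rightarrow> nat \<times> int" where
  "pt k j = (nat (k mod int m), (j + t * (k div int m)) mod int n)"

abbreviation V :: "(nat \<times> int) set" where
  "V \<equiv> {0..<m} \<times> {0..<int n}"

text \<open>All integers \<open>k\<close> and \<open>j\<close> are allowed, so each dart has many
  descriptions; \<open>darts_iff\<close> shows that the choice of description of the tail does not
  matter.\<close>

definition darts :: "((nat \<times> int) \<times> (nat \<times> int)) set" where
  "darts = {(pt k j, pt (k + 1) l) | k j l. l = j \<or> l = j + R k}"

lemma R_of_nat: "[R (int i) = r ^ i] (mod int n)"
proof -
  have "r ^ i = (r ^ m) ^ (i div m) * r ^ (i mod m)"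
    by (metis mult_div_mod_eq power_add power_mult)
  also have "[\<dots> = 1 ^ (i div m) * r ^ (i mod m)] (mod int n)"
    by (intro cong_mult cong_pow r_pow_m cong_refl)
  also have "1 ^ (i div m) * r ^ (i mod m) = R (int i)"
    by (simp add: R_def flip: zmod_int)
  finally show ?thesis by (rule cong_sym)
qed

lemma R_periodic: "R (k + int m * q) = R k"
  by (simp add: R_def)

lemma R_eq_pow:
  assumes "[k = int i] (mod int m)" shows "[R k = r ^ i] (mod int n)"
  using R_of_nat[of i] assms by (simp add: R_def cong_def)

lemma int_cong_nat: obtains i :: nat where "[k = int i] (mod int m)"
  using that[of "nat (k mod int m)"] m_pos by simp

lemma R_add: "[R (k + l) = R k * R l] (mod int n)"
proof -
  obtain i j :: nat where ij: "[k = int i] (mod int m)" "[l = int j] (mod int m)"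
    using int_cong_nat by metis
  have "[k + l = int (i + j)] (mod int m)"
    using cong_add[OF ij] by simp
  then have "[R (k + l) = r ^ (i + j)] (mod int n)" by (rule R_eq_pow)
  also have "r ^ (i + j) = r ^ i * r ^ j" by (rule power_add)
  also have "[\<dots> = R k * R l] (mod int n)"
    using ij by (intro cong_mult cong_sym[OF R_eq_pow])
  finally show ?thesis .
qed

lemma R_0: "R 0 = 1" by (simp add: R_def)

lemma R_1: "[R 1 = r] (mod int n)" using R_of_nat[of 1] by simp

lemma coprime_R: "coprime (R k) (int n)"
  using coprime_r by (simp add: R_def)

lemma t_pow: "[r ^ i * t = t] (mod int n)"
proof (induction i)
  case (Suc i)
  have "[r ^ i * (t * (r - 1)) = r ^ i * 0] (mod int n)"
    using tr by (rule cong_scalar_left)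
  then have "[r ^ Suc i * t = r ^ i * t] (mod int n)"
    by (simp add: cong_iff_dvd_diff algebra_simps)
  with Suc show ?case using cong_trans by blast
qed simp

lemma R_t: "[R k * t = t] (mod int n)"
  unfolding R_def by (rule t_pow)

lemma R_cancel: "[R k * x = R k * y] (mod int n) \<longleftrightarrow> [x = y] (mod int n)"
  using coprime_R by (rule cong_mult_lcancel)

lemma not_cong_R: "\<not> [R k = 0] (mod int n)"
  using R_cancel[of k 1 0] n_ge by (auto simp: cong_def)

text \<open>Cancelling the unit \<open>R k\<close> would leave \<open>n\<close> dividing 2. Because
  of this, the two signs that can occur at a level exclude each other.\<close>

lemma not_cong_double_R: "\<not> [R k = - R k] (mod int n)"
proof
  assume "[R k = - R k] (mod int n)"
  then have "[R k * 2 = R k * 0] (mod int n)" by (simp add: cong_iff_dvd_diff mult.commute)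
  then have "[2 = 0] (mod int n)" by (simp only: R_cancel)
  then have "int n dvd 2" by (simp add: cong_0_iff)
  with n_ge show False using zdvd_imp_le by fastforce
qed

lemma pt_shift: "pt (k + int m * q) j = pt k (j + t * q)"
  using m_pos by (simp add: pt_def algebra_simps)

lemma pt_eq_iff: "pt k j = pt k l \<longleftrightarrow> [j = l] (mod int n)"
proof -
  have "pt k j = pt k l \<longleftrightarrow> [j + t * (k div int m) = l + t * (k div int m)] (mod int n)"
    by (simp add: pt_def cong_def)
  then show ?thesis by (simp only: cong_add_rcancel)
qed

text \<open>This is the converse of \<open>pt_shift\<close>: whole turns around the levels are the
  only source of coincidences, apart from indices congruent modulo \<open>n\<close>.\<close>

lemma pt_eqD:
  assumes "pt k j = pt k' j'"
  obtains q where "k' = k + int m * q" "[j = j' + t * q] (mod int n)"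
proof -
  from assms m_pos have "k mod int m = k' mod int m" by (simp add: pt_def nat_eq_iff)
  then obtain q where q: "k' = k + int m * q"
    by (metis cong_def cong_iff_lin)
  with assms have "pt k j = pt k (j' + t * q)" by (simp add: pt_shift)
  with that[OF q] show thesis by (simp add: pt_eq_iff)
qed

lemma pt_in_V: "pt k j \<in> V"
  using m_pos n_ge by (simp add: pt_def nat_less_iff)

lemma pt_base: "(i, j) \<in> V \<Longrightarrow> pt (int i) j = (i, j)"
  by (auto simp: pt_def)

lemma V_cases:
  assumes "v \<in> V" obtains i j where "v = pt (int i) j" "i < m" 
  using assms that pt_base by (metis SigmaE atLeastLessThan_iff)

text \<open>Only the tail is moved to a level \<open>i < m\<close>. The head stays at
  \<open>int i + 1\<close>, which may be \<open>m\<close>, so a wrap-around dart looks like any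
  other.\<close>

lemma pt_cases:
  obtains i l where "pt k j = pt (int i) l" "i < m" "pt (k + 1) j = pt (int i + 1) l" "R k = R (int i)"
    "pt (k + 1) (j + R k) = pt (int i + 1) (l + R (int i))"
proof -
  let ?i = "nat (k mod int m)" and ?q = "k div int m"
  have k: "k = int ?i + int m * ?q" "k + 1 = (int ?i + 1) + int m * ?q"
    using m_pos by simp_all
  show thesis
  proof (rule that[of ?i "j + t * ?q"])
    show "R k = R (int ?i)" using k(1) R_periodic by metis
    then show "pt (k + 1) (j + R k) = pt (int ?i + 1) (j + t * ?q + R (int ?i))"
      using k(2) pt_shift[of "int ?i + 1" ?q "j + R k"] by (simp add: algebra_simps)
    show "pt k j = pt (int ?i) (j + t * ?q)" using k(1) pt_shift by metis
    show "pt (k + 1) j = pt (int ?i + 1) (j + t * ?q)" using k(2) pt_shift by metis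
  qed (use m_pos in \<open>simp add: nat_less_iff\<close>)
qed

text \<open>Another description of the tail differs by \<open>q\<close> turns. This shifts the
  indices of tail and head alike by \<open>t * q\<close> and leaves \<open>R k\<close>
  unchanged.\<close>

lemma darts_iff:
  "(pt k j, w) \<in> darts \<longleftrightarrow> w = pt (k + 1) j \<or> w = pt (k + 1) (j + R k)"
proof
  assume "(pt k j, w) \<in> darts"
  then obtain k' j' l' where eq: "pt k j = pt k' j'" and w: "w = pt (k' + 1) l'"
    and l': "l' = j' \<or> l' = j' + R k'"
    by (auto simp: darts_def)
  from eq obtain q where q: "k' = k + int m * q" "[j = j' + t * q] (mod int n)"
    by (rule pt_eqD)
  have "k' + 1 = (k + 1) + int m * q" using q by simp
  then have "w = pt (k + 1) (l' + t * q)" using w pt_shift by metis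
  moreover have "R k' = R k" using q R_periodic by simp
  moreover have "[l' + t * q = j + (l' - j')] (mod int n)"
    using cong_add[OF cong_sym[OF q(2)] cong_refl[of "l' - j'"]] by (simp add: algebra_simps)
  ultimately show "w = pt (k + 1) j \<or> w = pt (k + 1) (j + R k)"
    using l' by (auto simp: pt_eq_iff)
qed (auto simp: darts_def)

lemma darts_into_iff:
  "(w, pt (k + 1) l) \<in> darts \<longleftrightarrow> w = pt k l \<or> w = pt k (l - R k)"
proof
  assume "(w, pt (k + 1) l) \<in> darts"
  then obtain k' j' l' where w: "w = pt k' j'" and eq: "pt (k + 1) l = pt (k' + 1) l'"
    and l': "l' = j' \<or> l' = j' + R k'"
    by (auto simp: darts_def)
  from eq obtain q where q: "k' + 1 = k + 1 + int m * q" "[l = l' + t * q] (mod int n)"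
    by (rule pt_eqD)
  from q have k': "k' = k + int m * q" by simp
  then have "w = pt k (j' + t * q)" using w pt_shift by simp
  moreover have "R k' = R k" using k' R_periodic by simp
  moreover have "[j' + t * q = l + (j' - l')] (mod int n)"
    using cong_add[OF cong_sym[OF q(2)] cong_refl[of "j' - l'"]] by (simp add: algebra_simps)
  ultimately show "w = pt k l \<or> w = pt k (l - R k)"
    using l' by (auto simp: pt_eq_iff)
next
  show "w = pt k l \<or> w = pt k (l - R k) \<Longrightarrow> (w, pt (k + 1) l) \<in> darts"
    by (auto simp: darts_iff)
qed

lemma darts_in_V: "darts \<subseteq> V \<times> V"
  using pt_in_V unfolding darts_def by blast

text \<open>Every vertex has exactly two out-neighbours, distinct because \<open>R k\<close> is
  nonzero modulo \<open>n\<close>. The count later replaces the construction of inverse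
  maps.\<close>

lemma card_darts: "card darts = 2 * (m * n)"
proof -
  have out: "card {w. (v, w) \<in> darts} = 2" if "v \<in> V" for v
  proof -
    from that obtain i j where v: "v = pt (int i) j" by (rule V_cases)
    have "pt (int i + 1) j \<noteq> pt (int i + 1) (j + R (int i))"
      using not_cong_R[of "int i"] cong_add_lcancel_0[of j "R (int i)" "int n"]
      by (simp add: pt_eq_iff cong_sym_eq)
    moreover have "{w. (v, w) \<in> darts} = {pt (int i + 1) j, pt (int i + 1) (j + R (int i))}"
      by (auto simp: v darts_iff)
    ultimately show ?thesis by simp
  qed
  have "finite {w. (v, w) \<in> darts}" for v
    using darts_in_V by (auto intro: finite_subset[of _ V])
  then have "card (Sigma V (\<lambda>v. {w. (v, w) \<in> darts})) = (\<Sum>v\<in>V. 2)"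
    using out by simp
  moreover have "darts = Sigma V (\<lambda>v. {w. (v, w) \<in> darts})" using darts_in_V by auto
  ultimately show ?thesis by simp
qed

lemma edges_Xe_iff: "{u, v} \<in> edges (Xe m n r t) \<longleftrightarrow> (u, v) \<in> darts \<or> (v, u) \<in> darts"
proof -
  let ?B = "\<lambda>u v. \<exists>i l. i < m \<and> u = pt (int i) l \<and>
     (v = pt (int i + 1) l \<or> v = pt (int i + 1) (l + R (int i)))"
  have darts: "(u, v) \<in> darts \<longleftrightarrow> ?B u v" for u v
  proof
    assume "(u, v) \<in> darts"
    then obtain k j where "u = pt k j" "v = pt (k + 1) j \<or> v = pt (k + 1) (j + R k)"
      by (auto simp: darts_def)
    then show "?B u v" using pt_cases[of k j] by metis
  next
    show "?B u v \<Longrightarrow> (u, v) \<in> darts" by (auto simp: darts_iff)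
  qed
  \<comment> \<open>For \<open>i = m - 1\<close> the level \<open>i + 1\<close> is level 0 with the
    index raised by \<open>t\<close>; this produces the two families of wrap-around edges.\<close>
  have step: "pt (int i + 1) l = (if i < m - 1 then (i + 1, l mod int n) else (0, (l + t) mod int n))"
    if "i < m" for i l
  proof (cases "i < m - 1")
    case True
    then show ?thesis by (simp add: pt_def nat_add_distrib)
  next
    case False
    with that have "int i + 1 = 0 + int m * 1" by simp
    with False show ?thesis by (simp only: pt_shift) (simp add: pt_def)
  qed
  have Ri: "R (int i) = r ^ i" if "i < m" for i using that by (simp add: R_def)
  have pt0: "pt (int i) l = (i, l mod int n)" if "i < m" for i l using that by (simp add: pt_def)
  have B: "?B u v \<longleftrightarrow> (\<exists>i l. i < m - 1 \<and> l \<in> {0..<int n} \<and> u = (i, l) \<and> v = (i + 1, l)) \<or>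
     (\<exists>i l. i < m - 1 \<and> l \<in> {0..<int n} \<and> u = (i, l) \<and> v = (i + 1, (l + r ^ i) mod int n)) \<or>
     (\<exists>l. l \<in> {0..<int n} \<and> u = (m - 1, l) \<and> v = (0, (l + t) mod int n)) \<or>
     (\<exists>l. l \<in> {0..<int n} \<and> u = (m - 1, l) \<and> v = (0, (l + r ^ (m - 1) + t) mod int n))"
    (is "_ \<longleftrightarrow> ?C u v") for u v
  proof
    assume "?B u v"
    then obtain i l where i: "i < m" and u: "u = pt (int i) l"
      and v: "v = pt (int i + 1) l \<or> v = pt (int i + 1) (l + R (int i))" by blast
    have l: "l mod int n \<in> {0..<int n}" using n_ge by simp
    show "?C u v"
    proof (cases "i < m - 1")
      case True
      with v l i show ?thesis unfolding u pt0[OF i] step[OF i] Ri[OF i]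
        by (auto simp: mod_add_left_eq)
    next
      case False
      with i have "i = m - 1" by simp
      with v l i show ?thesis unfolding u pt0[OF i] step[OF i] Ri[OF i]
        by (auto simp: mod_add_left_eq mod_add_eq add.assoc)
    qed
  next
    assume "?C u v"
    then obtain i l where i: "i < m" and l: "l \<in> {0..<int n}" and u: "u = (i, l)"
      and v: "v = pt (int i + 1) l \<or> v = pt (int i + 1) (l + R (int i))"
      using m_pos by (elim disjE exE conjE) (fastforce simp: step Ri)+
    then show "?B u v" by (intro exI[of _ i] exI[of _ l]) (simp add: pt0)
  qed
  \<comment> \<open>The edge families are rewritten as sets of doubletons of related pairs, so that
    their union becomes the disjunction \<open>?C\<close>.\<close>
  have doubletons: "{{f i l, g i l} | i l. P i l} = {{a, b} | a b. \<exists>i l. P i l \<and> a = f i l \<and> b = g i l}"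
    for f g :: "nat \<Rightarrow> int \<Rightarrow> nat \<times> int" and P
    by blast
  have doubletons': "{{f l, g l} | l. P l} = {{a, b} | a b. \<exists>l. P l \<and> a = f l \<and> b = g l}"
    for f g :: "int \<Rightarrow> nat \<times> int" and P
    by blast
  have doubletons_Un: "{{a, b} | a b. P a b} \<union> {{a, b} | a b. Q a b} = {{a, b} | a b. P a b \<or> Q a b}"
    for P Q :: "nat \<times> int \<Rightarrow> nat \<times> int \<Rightarrow> bool"
    by blast
  have "edges (Xe m n r t) = {{a, b} | a b. ?C a b}"
    unfolding Xe_def ugraph.select_convs doubletons doubletons' doubletons_Un
    by (simp only: conj_assoc disj_assoc)
  also have "\<dots> = {{a, b} | a b. (a, b) \<in> darts}"
    unfolding darts B ..
  finally show ?thesis by (simp only: mem_Collect_eq doubleton_eq_iff) blast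
qed

lemma verts_Xe: "verts (Xe m n r t) = V" by (simp add: Xe_def)

end

section \<open>Affine and reversing isomorphisms\<close>

locale Xe_same_size = X: Xe_graph m n r t + Y: Xe_graph m n r' t'
  for m n :: nat and r t r' t' :: int
begin

text \<open>An injective map of the finite vertex set is bijective, and it sends the darts
  injectively into a set of equal size. Hence every target dart, up to the common orientation, is an
  image, and edges are reflected as well.\<close>

lemma graph_isomorphism_if_darts:
  assumes inj: "inj_on f X.V"
    and hom: "(\<forall>(u, v) \<in> X.darts. (f u, f v) \<in> Y.darts) \<or> (\<forall>(u, v) \<in> X.darts. (f v, f u) \<in> Y.darts)"
  shows "graph_isomorphism (Xe m n r t) (Xe m n r' t') f"
proof -
  have "f ` X.V \<subseteq> X.V"
  proof
    fix w assume "w \<in> f ` X.V"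
    then obtain v where "v \<in> X.V" "w = f v" by blast
    then obtain i j where w: "w = f (X.pt (int i) j)" using X.V_cases by metis
    have "(X.pt (int i) j, X.pt (int i + 1) j) \<in> X.darts" by (simp add: X.darts_iff)
    with hom w Y.darts_in_V show "w \<in> X.V" by blast
  qed
  with inj have bij: "bij_betw f X.V X.V"
    by (simp add: bij_betw_def endo_inj_surj)
  define D where "D = (if \<forall>(u, v) \<in> X.darts. (f u, f v) \<in> Y.darts then Y.darts else Y.darts\<inverse>)"
  have D: "map_prod f f ` X.darts \<subseteq> D"
    using hom by (auto simp: D_def)
  have fin: "finite Y.darts" "finite X.darts"
    using X.darts_in_V Y.darts_in_V by (auto intro: finite_subset[of _ "X.V \<times> X.V"])
  have inj2: "inj_on (map_prod f f) (X.V \<times> X.V)"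
    using inj by (intro map_prod_inj_on)
  have "card (map_prod f f ` X.darts) = card X.darts"
    using inj2 X.darts_in_V by (intro card_image) (rule inj_on_subset)
  also have "\<dots> = card D"
    using X.card_darts Y.card_darts by (simp add: D_def card_inverse)
  finally have D_eq: "map_prod f f ` X.darts = D"
    using D fin by (intro card_subset_eq) (auto simp: D_def)
  have "(u, v) \<in> X.darts \<longleftrightarrow> (f u, f v) \<in> D" if "u \<in> X.V" "v \<in> X.V" for u v
    using inj_on_image_mem_iff[OF inj2, of "(u, v)" X.darts] that X.darts_in_V
    by (simp add: D_eq)
  then have "{u, v} \<in> edges (Xe m n r t) \<longleftrightarrow> {f u, f v} \<in> edges (Xe m n r' t')"
    if "u \<in> X.V" "v \<in> X.V" for u v
    using that by (auto simp: X.edges_Xe_iff Y.edges_Xe_iff D_def)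
  with bij show ?thesis
    by (simp add: graph_isomorphism_def X.verts_Xe Y.verts_Xe)
qed

text \<open>The map shifts levels by \<open>a\<close> and acts on level \<open>i\<close> with slope
  \<open>s\<close> and translation \<open>b i\<close>. The alternatives in \<open>step\<close> say
  that the two out-neighbours keep their roles or swap them; \<open>closing\<close> makes the map
  agree on level \<open>m\<close> and on level 0 shifted by \<open>t\<close>.\<close>

lemma affine_isomorphism:
  fixes s a :: int and b :: "nat \<Rightarrow> int"
  assumes s: "coprime s (int n)"
    and step: "\<And>i. i < m \<Longrightarrow>
      [s * X.R (int i) = Y.R (int i + a)] (mod int n) \<and> [b (Suc i) = b i] (mod int n) \<or>
      [s * X.R (int i) = - Y.R (int i + a)] (mod int n) \<and> [b (Suc i) = b i + Y.R (int i + a)] (mod int n)"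
    and closing: "[b m + t' = b 0 + s * t] (mod int n)"
  obtains f where "graph_isomorphism (Xe m n r t) (Xe m n r' t') f"
    and "\<And>i j. i \<le> m \<Longrightarrow> f (X.pt (int i) j) = Y.pt (int i + a) (s * j + b i)"
proof -
  define f where "f = (\<lambda>(i, j). Y.pt (int i + a) (s * j + b i))"
  have f_less: "f (X.pt (int i) j) = Y.pt (int i + a) (s * j + b i)" if "i < m" for i j
  proof -
    have "X.pt (int i) j = (i, j mod int n)" using that by (simp add: X.pt_def)
    then show ?thesis unfolding f_def Y.pt_eq_iff
      by (auto simp: Y.pt_eq_iff intro!: cong_add cong_mult)
  qed
  \<comment> \<open>The case \<open>i = m\<close> is needed for heads of darts leaving level
    \<open>m - 1\<close>; it goes through level 0, where \<open>closing\<close> applies.\<close>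
  have f_pt: "f (X.pt (int i) j) = Y.pt (int i + a) (s * j + b i)" if "i \<le> m" for i j
  proof (cases "i = m")
    case True
    have "f (X.pt (int m) j) = f (X.pt (int 0) (j + t))"
      using X.pt_shift[of 0 1 j] by simp
    also have "\<dots> = Y.pt a (s * (j + t) + b 0)"
      using f_less[of 0] X.m_pos by simp
    also have "\<dots> = Y.pt a (s * j + b m + t')"
      unfolding Y.pt_eq_iff by (rule cong_lincomb1[OF closing, of _ _ "-1"]) (simp add: algebra_simps)
    also have "\<dots> = Y.pt (int m + a) (s * j + b m)"
      using Y.pt_shift[of a 1 "s * j + b m"] by (simp add: add.commute)
    finally show ?thesis using True by simp
  qed (use that f_less in simp)
  have inj: "inj_on f X.V"
  proof (rule inj_onI)
    fix u v assume "u \<in> X.V" "v \<in> X.V" and eq: "f u = f v"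
    then obtain i j k l where u: "u = X.pt (int i) j" "i < m" and v: "v = X.pt (int k) l" "k < m"
      by (metis X.V_cases)
    from eq u v have *: "Y.pt (int i + a) (s * j + b i) = Y.pt (int k + a) (s * l + b k)"
      by (simp add: f_less)
    then obtain q where "int k + a = int i + a + int m * q" by (rule Y.pt_eqD)
    then have "int k mod int m = int i mod int m" by simp
    with u v have ik: "i = k" by simp
    with * have "[s * j = s * l] (mod int n)" by (simp only: Y.pt_eq_iff cong_add_rcancel)
    then have "[j = l] (mod int n)" using s by (simp add: cong_mult_lcancel)
    with u v ik show "u = v" by (simp add: X.pt_eq_iff)
  qed
  have hom: "(f u, f v) \<in> Y.darts" if "(u, v) \<in> X.darts" for u v
  proof -
    from that obtain k j where "u = X.pt k j" "v = X.pt (k + 1) j \<or> v = X.pt (k + 1) (j + X.R k)"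
      by (auto simp: X.darts_def)
    then obtain i l where i: "i < m" and u: "u = X.pt (int i) l"
      and v: "v = X.pt (int (Suc i)) l \<or> v = X.pt (int (Suc i)) (l + X.R (int i))"
      using X.pt_cases[of k j] by (metis of_nat_Suc add.commute)
    have fu: "f u = Y.pt (int i + a) (s * l + b i)" using u i by (simp add: f_pt)
    have fv: "f v = Y.pt (int i + a + 1) (s * l + b (Suc i)) \<or>
      f v = Y.pt (int i + a + 1) (s * (l + X.R (int i)) + b (Suc i))"
      using v i f_pt[of "Suc i"] by (auto simp: algebra_simps)
    from step[OF i] show ?thesis
    proof (elim disjE conjE)
      assume s: "[s * X.R (int i) = Y.R (int i + a)] (mod int n)" and b: "[b (Suc i) = b i] (mod int n)"
      have "[s * l + b (Suc i) = s * l + b i] (mod int n)"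
        by (rule cong_lincomb1[OF b, of _ _ 1]) simp
      moreover have "[s * (l + X.R (int i)) + b (Suc i) = s * l + b i + Y.R (int i + a)] (mod int n)"
        by (rule cong_lincomb2[OF b s, of _ _ 1 1]) (simp add: algebra_simps)
      ultimately show ?thesis using fv unfolding fu Y.darts_iff by (metis Y.pt_eq_iff)
    next
      assume s: "[s * X.R (int i) = - Y.R (int i + a)] (mod int n)"
        and b: "[b (Suc i) = b i + Y.R (int i + a)] (mod int n)"
      have "[s * l + b (Suc i) = s * l + b i + Y.R (int i + a)] (mod int n)"
        by (rule cong_lincomb1[OF b, of _ _ 1]) simp
      moreover have "[s * (l + X.R (int i)) + b (Suc i) = s * l + b i] (mod int n)"
        by (rule cong_lincomb2[OF b s, of _ _ 1 1]) (simp add: algebra_simps)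
      ultimately show ?thesis using fv unfolding fu Y.darts_iff by (metis Y.pt_eq_iff)
    qed
  qed
  show thesis
    by (rule that[of f, OF graph_isomorphism_if_darts[OF inj]]) (use hom f_pt in auto)
qed

text \<open>Level \<open>k\<close> goes to level \<open>- k\<close>, and indices are multiplied by
  \<open>- r\<close>. A step of size \<open>r ^ k\<close> becomes \<open>r ^ (k + 1)\<close> up to
  sign, which is the step of the target at level \<open>- k - 1\<close>; the wrap-around is
  respected since \<open>r * t\<close> is congruent to \<open>t\<close>.\<close>

lemma reversing_isomorphism:
  assumes rr': "[r * r' = 1] (mod int n)" and tt': "[t' = t] (mod int n)"
  obtains f where "graph_isomorphism (Xe m n r t) (Xe m n r' t') f"
    and "\<And>u v. (u, v) \<in> X.darts \<Longrightarrow> (f v, f u) \<in> Y.darts"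
proof -
  define f where "f = (\<lambda>(i, j). Y.pt (- int i) (- r * j))"
  have f_pt: "f (X.pt k j) = Y.pt (- k) (- r * j)" for k j
  proof -
    have k: "- int (nat (k mod int m)) = - k + int m * (k div int m)"
      using X.m_pos minus_div_mult_eq_mod[of k "int m"] by (simp add: algebra_simps)
    have "f (X.pt k j) = Y.pt (- k) (- r * ((j + t * (k div int m)) mod int n) + t' * (k div int m))"
      unfolding X.pt_def f_def prod.case k Y.pt_shift ..
    also have "\<dots> = Y.pt (- k) (- r * (j + t * (k div int m)) + t' * (k div int m))"
      unfolding Y.pt_eq_iff by (intro cong_add cong_mult cong_refl) simp
    also have "\<dots> = Y.pt (- k) (- r * j)"
    proof -
      let ?q = "k div int m"
      show ?thesis unfolding Y.pt_eq_iff
        by (rule cong_lincomb2[OF X.tr tt', of _ _ "- ?q" ?q]) (simp add: algebra_simps)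
    qed
    finally show ?thesis .
  qed
  have inj: "inj_on f X.V"
  proof (rule inj_onI)
    fix u v assume "u \<in> X.V" "v \<in> X.V" and eq: "f u = f v"
    then obtain i j k l where u: "u = X.pt (int i) j" "i < m" and v: "v = X.pt (int k) l" "k < m"
      by (metis X.V_cases)
    from eq u v have *: "Y.pt (- int i) (- r * j) = Y.pt (- int k) (- r * l)"
      by (simp add: f_pt)
    then obtain q where "- int k = - int i + int m * q" by (rule Y.pt_eqD)
    then have "int i = int k + int m * q" by simp
    then have "int k mod int m = int i mod int m" by simp
    with u v have ik: "i = k" by simp
    have "coprime (- r) (int n)" using X.coprime_r by simp
    with * ik have "[j = l] (mod int n)" by (simp only: Y.pt_eq_iff cong_mult_lcancel)
    with u v ik show "u = v" by (simp add: X.pt_eq_iff)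
  qed
  \<comment> \<open>Both sides are inverses of \<open>Y.R (k + 1)\<close>.\<close>
  have R: "[r * X.R k = Y.R (- k - 1)] (mod int n)" for k
  proof -
    let ?l = "k + 1"
    obtain i :: nat where i: "[?l = int i] (mod int m)" by (rule X.int_cong_nat)
    have "[X.R ?l * Y.R ?l = r ^ i * r' ^ i] (mod int n)"
      by (intro cong_mult X.R_eq_pow Y.R_eq_pow i)
    also have "[r ^ i * r' ^ i = 1] (mod int n)"
      using cong_pow[OF rr', of i] by (simp add: power_mult_distrib)
    finally have XY: "[X.R ?l * Y.R ?l = 1] (mod int n)" .
    have YY: "[1 = Y.R ?l * Y.R (- ?l)] (mod int n)"
      using Y.R_add[of ?l "- ?l"] by (simp add: Y.R_0)
    have "[X.R k * r = X.R k * X.R 1] (mod int n)"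
      by (intro cong_scalar_left cong_sym[OF X.R_1])
    also have "[X.R k * X.R 1 = X.R ?l] (mod int n)" by (rule cong_sym[OF X.R_add])
    also have "[X.R ?l = Y.R (- ?l)] (mod int n)"
      by (rule cong_lincomb2[OF XY YY, of _ _ "Y.R (- ?l)" "X.R ?l"]) (simp add: algebra_simps)
    finally show ?thesis by (simp add: mult.commute)
  qed
  have hom: "(f v, f u) \<in> Y.darts" if "(u, v) \<in> X.darts" for u v
  proof -
    from that obtain k j where u: "u = X.pt k j" and v: "v = X.pt (k + 1) j \<or> v = X.pt (k + 1) (j + X.R k)"
      by (auto simp: X.darts_def)
    \<comment> \<open>The level \<open>- k\<close> is written as a successor to match
      \<open>darts_into_iff\<close>: the image of the tail is now the head.\<close>
    have fu: "f u = Y.pt (- k - 1 + 1) (- r * j)" using u by (simp add: f_pt)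
    have fv: "f v = Y.pt (- k - 1) (- r * j) \<or> f v = Y.pt (- k - 1) (- r * j - r * X.R k)"
    proof -
      have "- (k + 1) = - k - 1" "- r * (j + X.R k) = - r * j - r * X.R k"
        by (simp_all add: algebra_simps)
      with v show ?thesis by (auto simp only: f_pt)
    qed
    have "Y.pt (- k - 1) (- r * j - r * X.R k) = Y.pt (- k - 1) (- r * j - Y.R (- k - 1))"
      unfolding Y.pt_eq_iff by (intro cong_diff R cong_refl)
    with fv show ?thesis
      unfolding fu Y.darts_into_iff by metis
  qed
  show thesis
    by (rule that[of f, OF graph_isomorphism_if_darts[OF inj]]) (use hom in auto)
qed

end

section \<open>Transitivity on darts\<close>

context Xe_graph begin

text \<open>The base dart \<open>(pt 0 0, pt 1 0)\<close> reaches a dart with unchanged index by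
  slope \<open>R k\<close> and constant translation. For the other kind of dart the slope is
  \<open>- R k\<close>, and the roles of the out-neighbours are swapped at every level.\<close>

lemma dart_orbit:
  assumes sum: "[(\<Sum>i<m. r ^ i) + 2 * t = 0] (mod int n)" and "(x, y) \<in> darts"
  obtains f where "graph_automorphism (Xe m n r t) f" "f (pt 0 0) = x" "f (pt 1 0) = y"
proof -
  interpret self: Xe_same_size m n r t r t ..
  from assms(2) obtain k j where x: "x = pt k j" and y: "y = pt (k + 1) j \<or> y = pt (k + 1) (j + R k)"
    by (auto simp: darts_def)
  have R: "[R k * R (int i) = R (int i + k)] (mod int n)" for i
    using R_add[of "int i" k] by (simp add: cong_sym_eq mult.commute)
  from y show thesis
  proof
    assume y: "y = pt (k + 1) j"
    have "[j + t = j + R k * t] (mod int n)"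
      by (intro cong_add cong_refl cong_sym[OF R_t])
    then obtain f where f: "graph_automorphism (Xe m n r t) f"
      "\<And>i l. i \<le> m \<Longrightarrow> f (pt (int i) l) = pt (int i + k) (R k * l + j)"
      using self.affine_isomorphism[of "R k" k "\<lambda>_. j"] R coprime_R by (auto simp del: of_nat_add)
    with f(2)[of 0 0] f(2)[of 1 0] x y m_pos that[of f] show thesis
      by (simp add: add.commute)
  next
    assume y: "y = pt (k + 1) (j + R k)"
    \<comment> \<open>Each swap adds the step of its level, so a full turn adds \<open>R k\<close>
      times the sum of all powers of \<open>r\<close>. The condition on this sum and
      \<open>2 * t\<close> is what closes the map up.\<close>
    define b where "b = (\<lambda>i. j + R k * (\<Sum>l<i. r ^ l))"
    have "[b m + t = b 0 + - R k * t] (mod int n)"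
      by (rule cong_lincomb2[OF sum R_t[of k], of _ _ "R k" "-1"]) (simp add: b_def algebra_simps)
    moreover have "[- R k * R (int i) = - R (int i + k)] (mod int n)" for i
      using cong_uminus[OF R[of i]] by simp
    moreover have "[b (Suc i) = b i + R (int i + k)] (mod int n)" for i
      by (rule cong_lincomb2[OF R_of_nat[of i] R[of i], of _ _ "- R k" 1]) (simp add: b_def algebra_simps)
    moreover have "coprime (- R k) (int n)" using coprime_R by simp
    ultimately obtain f where f: "graph_automorphism (Xe m n r t) f"
      "\<And>i l. i \<le> m \<Longrightarrow> f (pt (int i) l) = pt (int i + k) (- R k * l + b i)"
      using self.affine_isomorphism[of "- R k" k b] by blast
    have "b 0 = j" "b 1 = j + R k" by (simp_all add: b_def)
    with f(2)[of 0 0] f(2)[of 1 0] f(1) x y m_pos that[of f] show thesis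
      by (simp add: add.commute)
  qed
qed

lemma darts_transitive:
  assumes sum: "[(\<Sum>i<m. r ^ i) + 2 * t = 0] (mod int n)"
    and "(u, v) \<in> darts" "(x, y) \<in> darts"
  obtains f where "graph_automorphism (Xe m n r t) f" "f u = x" "f v = y"
proof -
  obtain f where f: "graph_automorphism (Xe m n r t) f" "f (pt 0 0) = u" "f (pt 1 0) = v"
    using dart_orbit[OF sum assms(2)] .
  obtain g where g: "graph_automorphism (Xe m n r t) g" "g (pt 0 0) = x" "g (pt 1 0) = y"
    using dart_orbit[OF sum assms(3)] .
  let ?h = "inv_into (verts (Xe m n r t)) f"
  have "graph_automorphism (Xe m n r t) (g \<circ> ?h)"
    using f g graph_isomorphism_inv_into graph_isomorphism_comp by blast
  moreover have "inj_on f (verts (Xe m n r t))"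
    using f by (simp add: graph_isomorphism_def bij_betw_def)
  then have "?h u = pt 0 0" "?h v = pt 1 0"
    using pt_in_V f(2,3) by (metis inv_into_f_f verts_Xe)+
  ultimately show thesis using that[of "g \<circ> ?h"] g by simp
qed

end

section \<open>Isomorphisms preserve or reverse the orientation\<close>

locale Xe_pair = X: Xe_graph m n r t + Y: Xe_graph m' n' r' t'
  for m n m' n' :: nat and r t r' t' :: int
begin

text \<open>If \<open>f\<close> reversed the dart \<open>(u, v)\<close> but preserved
  \<open>(x, y)\<close>, dart transitivity of both graphs would give an automorphism swapping
  \<open>u\<close> and \<open>v\<close>. Reversed darts would then lie in the orbit of the darts,
  making the graph arc-transitive.\<close>

lemma isomorphism_darts_cases:
  assumes sumX: "[(\<Sum>i<m. r ^ i) + 2 * t = 0] (mod int n)"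
    and sumY: "[(\<Sum>i<m'. r' ^ i) + 2 * t' = 0] (mod int n')"
    and not_at: "\<not> arc_transitive (Xe m n r t)"
    and f: "graph_isomorphism (Xe m n r t) (Xe m' n' r' t') f"
  shows "(\<forall>(u, v) \<in> X.darts. (f u, f v) \<in> Y.darts) \<or> (\<forall>(u, v) \<in> X.darts. (f v, f u) \<in> Y.darts)"
proof (rule ccontr)
  let ?X = "Xe m n r t" and ?Y = "Xe m' n' r' t'"
  assume "\<not> ?thesis"
  then obtain u v x y where uv: "(u, v) \<in> X.darts" "(f u, f v) \<notin> Y.darts"
    and xy: "(x, y) \<in> X.darts" "(f y, f x) \<notin> Y.darts" by auto
  have V: "u \<in> verts ?X" "v \<in> verts ?X" "x \<in> verts ?X" "y \<in> verts ?X"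
    using uv(1) xy(1) X.darts_in_V by (auto simp: X.verts_Xe)
  have "{f u, f v} \<in> edges ?Y" "{f x, f y} \<in> edges ?Y"
    using graph_isomorphism_edges[OF f] V uv(1) xy(1) by (simp_all add: X.edges_Xe_iff)
  with uv(2) xy(2) have "(f v, f u) \<in> Y.darts" "(f x, f y) \<in> Y.darts"
    by (simp_all add: Y.edges_Xe_iff)
  \<comment> \<open>\<open>g\<close> carries the image of the preserved dart to the image of
    \<open>(u, v)\<close> traversed backwards.\<close>
  then obtain g where g: "graph_automorphism ?Y g" "g (f x) = f v" "g (f y) = f u"
    using Y.darts_transitive[OF sumY] by metis
  obtain h where h: "graph_automorphism ?X h" "h u = x" "h v = y"
    using X.darts_transitive[OF sumX uv(1) xy(1)] .
  define k where "k = inv_into (verts ?X) f \<circ> (g \<circ> (f \<circ> h))"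
  have k: "graph_automorphism ?X k"
    unfolding k_def using f g(1) h(1) graph_isomorphism_inv_into graph_isomorphism_comp by metis
  have "inj_on f (verts ?X)"
    using f by (simp add: graph_isomorphism_def bij_betw_def)
  then have swap: "k u = v" "k v = u"
    using V by (simp_all add: k_def h g)
  have "arc_transitive ?X"
  proof (rule arc_transitive_if_orbit[OF V(1,2)])
    fix p q assume "(p, q) \<in> arcs ?X"
    then consider "(p, q) \<in> X.darts" | "(q, p) \<in> X.darts"
      by (auto simp: arcs_def X.edges_Xe_iff)
    then show "\<exists>f. graph_automorphism ?X f \<and> f u = p \<and> f v = q"
    proof cases
      case 1
      then show ?thesis using X.darts_transitive[OF sumX uv(1)] by metis
    next
      case 2
      then obtain l where l: "graph_automorphism ?X l" "l u = q" "l v = p"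
        using X.darts_transitive[OF sumX uv(1)] by metis
      then have "graph_automorphism ?X (l \<circ> k)" using k graph_isomorphism_comp by metis
      with l swap show ?thesis by (intro exI[of _ "l \<circ> k"]) simp
    qed
  qed
  with not_at show False ..
qed

end

section \<open>Orientation preserving isomorphisms are affine on levels\<close>

context Xe_graph begin

text \<open>Distinct vertices of a level cannot reach \<open>w\<close> by the same kind of dart. So
  one reaches it with unchanged index and the other by adding \<open>R k\<close>.\<close>

lemma common_out_neighbour:
  assumes "(pt k x, w) \<in> darts" "(pt k y, w) \<in> darts" "pt k x \<noteq> pt k y"
  shows "[y = x + R k] (mod int n) \<and> w = pt (k + 1) y \<or>
         [x = y + R k] (mod int n) \<and> w = pt (k + 1) x"
  using assms unfolding darts_iff
  by (elim disjE) (auto simp: pt_eq_iff cong_add_rcancel intro: cong_sym)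

end

text \<open>
  If an orientation preserving isomorphism maps level 0 to level \<open>a\<close> with slope \<open>e * r' ^ a\<close>, then
  \<open>r' ^ a * drift n r r' e k\<close> is the translation it has accumulated at level \<open>k\<close>.
\<close>

definition drift :: "nat \<Rightarrow> int \<Rightarrow> int \<Rightarrow> int \<Rightarrow> nat \<Rightarrow> int" where
  "drift n r r' e k = (\<Sum>i<k. if [e * r ^ i = r' ^ i] (mod int n) then 0 else r' ^ i)"

context Xe_pair begin

text \<open>The sign \<open>e\<close> is read off on level 0, and shared out-neighbours carry the
  affine form upwards level by level. The last conclusion compares level \<open>m\<close> with level
  0 shifted by \<open>t\<close>.\<close>

lemma dart_preserving_isomorphism:
  assumes f: "graph_isomorphism (Xe m n r t) (Xe m' n' r' t') f"
    and hom: "\<forall>(u, v) \<in> X.darts. (f u, f v) \<in> Y.darts"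
  obtains e where "e \<in> {1, -1}" "m' = m" "n' = n"
    "\<And>k :: nat. [e * r ^ k = r' ^ k] (mod int n) \<or> [e * r ^ k = - (r' ^ k)] (mod int n)"
    "[drift n r r' e m + t' = e * t] (mod int n)"
proof -
  have hom': "(f u, f v) \<in> Y.darts" if "(u, v) \<in> X.darts" for u v
    using hom that by blast
  have inj: "f (X.pt k j) = f (X.pt k' j') \<longleftrightarrow> X.pt k j = X.pt k' j'" for k j k' j'
  proof -
    have "inj_on f X.V" using f by (simp add: graph_isomorphism_def bij_betw_def X.verts_Xe)
    then show ?thesis using X.pt_in_V X.pt_in_V by (rule inj_on_eq_iff)
  qed
  have "f (X.pt 0 0) \<in> Y.V"
    using graph_isomorphism_in_verts[OF f] X.pt_in_V by (simp only: X.verts_Xe Y.verts_Xe)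
  then obtain i c where f0: "f (X.pt 0 0) = Y.pt (int i) c" by (rule Y.V_cases)
  define a where "a = int i"
  \<comment> \<open>The vertices \<open>j\<close> and \<open>j + 1\<close> of level 0 share the
    out-neighbour with index \<open>j + 1\<close> on level 1, so their images differ by the step of
    level \<open>a\<close> up to sign.\<close>
  have next_j: "\<exists>d\<in>{1, -1}. f (X.pt 0 (j + 1)) = Y.pt a (x + d * Y.R a)"
    if x: "f (X.pt 0 j) = Y.pt a x" for j x
  proof -
    let ?w = "f (X.pt (0 + 1) (j + 1))"
    have darts: "(f (X.pt 0 j), ?w) \<in> Y.darts" "(f (X.pt 0 (j + 1)), ?w) \<in> Y.darts"
      by (simp_all add: hom' X.darts_iff X.R_0)
    obtain z where "?w = Y.pt (a + 1) z"
      using darts(1) x Y.darts_iff by auto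
    with darts(2) obtain y where y: "f (X.pt 0 (j + 1)) = Y.pt a y"
      using Y.darts_into_iff by auto
    have "\<not> [1 = 0] (mod int n)" using X.n_ge by (simp add: cong_def)
    then have "X.pt 0 j \<noteq> X.pt 0 (j + 1)"
      using cong_add_lcancel_0[of j 1 "int n"] by (simp add: X.pt_eq_iff cong_sym_eq)
    then have "Y.pt a x \<noteq> Y.pt a y"
      using inj x y by metis
    with darts x y have "[y = x + Y.R a] (mod int n') \<or> [x = y + Y.R a] (mod int n')"
      using Y.common_out_neighbour[of a x ?w y] by auto
    then have "[y = x + 1 * Y.R a] (mod int n') \<or> [y = x + (-1) * Y.R a] (mod int n')"
      by (auto simp: cong_iff_dvd_diff dvd_diff_commute algebra_simps)
    with y show ?thesis using Y.pt_eq_iff by auto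
  qed
  obtain e where e: "e \<in> {1, -1}" and f1: "f (X.pt 0 1) = Y.pt a (c + e * Y.R a)"
    using next_j[OF f0[folded a_def]] unfolding add_0 by blast
  have level0_nat: "f (X.pt 0 (int j)) = Y.pt a (Y.R a * (e * int j) + c) \<and>
     f (X.pt 0 (int j + 1)) = Y.pt a (Y.R a * (e * (int j + 1)) + c)" for j :: nat
  proof (induction j)
    case 0
    show ?case using f0 f1 by (simp add: a_def algebra_simps)
  next
    case (Suc j)
    let ?x = "Y.R a * (e * (int j + 1)) + c"
    obtain d where d: "d \<in> {1, -1}" and d': "f (X.pt 0 (int j + 1 + 1)) = Y.pt a (?x + d * Y.R a)"
      using next_j Suc by blast
    \<comment> \<open>A change of sign would lead back to the image of the vertex two places
      earlier, against injectivity.\<close>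
    have "d = e"
    proof (rule ccontr)
      assume "d \<noteq> e"
      with d e have "d = - e" by auto
      then have "?x + d * Y.R a = Y.R a * (e * int j) + c" by (simp add: algebra_simps)
      with d' Suc have "X.pt 0 (int j + 1 + 1) = X.pt 0 (int j)"
        using inj by metis
      then have "[2 = 0] (mod int n)"
        by (simp add: X.pt_eq_iff cong_iff_dvd_diff)
      then have "int n dvd 2" by (simp add: cong_0_iff)
      with X.n_ge show False using zdvd_imp_le by fastforce
    qed
    with d' have "f (X.pt 0 (int j + 1 + 1)) = Y.pt a (Y.R a * (e * (int j + 1 + 1)) + c)"
      by (simp add: algebra_simps)
    with Suc show ?case by (simp add: add.commute)
  qed
  have "coprime e (int n')" using e by auto
  then have Re_cancel: "[Y.R a * (e * x) = Y.R a * (e * y)] (mod int n') \<longleftrightarrow> [x = y] (mod int n')" for x y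
    by (simp only: Y.R_cancel cong_mult_lcancel)
  \<comment> \<open>Going once around level 0 returns to the start, so the affine formula forces
    \<open>n'\<close> to divide \<open>n\<close>.\<close>
  have "X.pt 0 (int n) = X.pt 0 (int 0)" by (simp add: X.pt_eq_iff cong_def)
  then have "Y.pt a (Y.R a * (e * int n) + c) = Y.pt a (Y.R a * (e * int 0) + c)"
    using level0_nat by metis
  then have "[int n = int 0] (mod int n')"
    by (simp only: Y.pt_eq_iff cong_add_rcancel Re_cancel)
  then have n'_dvd: "int n' dvd int n" by (simp add: cong_0_iff)
  have level0: "f (X.pt 0 j) = Y.pt a (Y.R a * (e * j) + c)" for j
  proof -
    have nat: "int (nat (j mod int n)) = j mod int n" using X.n_ge by simp
    have "[j = j mod int n] (mod int n)" by simp
    then have "X.pt 0 j = X.pt 0 (j mod int n)" and *: "[j = j mod int n] (mod int n')"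
      using n'_dvd by (auto simp only: X.pt_eq_iff intro: cong_dvd_mono_modulus)
    then have "f (X.pt 0 j) = Y.pt a (Y.R a * (e * (j mod int n)) + c)"
      using level0_nat[of "nat (j mod int n)"] nat by simp
    also have "\<dots> = Y.pt a (Y.R a * (e * j) + c)"
      using * by (simp only: Y.pt_eq_iff cong_add_rcancel Re_cancel cong_sym_eq)
    finally show ?thesis .
  qed
  have level: "(\<forall>j. f (X.pt (int k) j) = Y.pt (int k + a) (Y.R a * (e * j + drift n' r r' e k) + c))"
    and sign: "[e * r ^ k = r' ^ k] (mod int n') \<or> [e * r ^ k = - (r' ^ k)] (mod int n')" for k :: nat
  proof -
    have step: "([e * r ^ k = r' ^ k] (mod int n') \<or> [e * r ^ k = - (r' ^ k)] (mod int n')) \<and>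
        f (X.pt (int (Suc k)) j) = Y.pt (int (Suc k) + a) (Y.R a * (e * j + drift n' r r' e (Suc k)) + c)"
      if IH: "\<forall>j. f (X.pt (int k) j) = Y.pt (int k + a) (Y.R a * (e * j + drift n' r r' e k) + c)" for k j
    proof -
      let ?w = "X.pt (int k + 1) j"
      let ?x = "\<lambda>j. Y.R a * (e * j + drift n' r r' e k) + c"
      have Rk: "[X.R (int k) = r ^ k] (mod int n')"
        using X.R_of_nat n'_dvd by (rule cong_dvd_mono_modulus)
      have R'k: "[Y.R (int k + a) = r' ^ k * Y.R a] (mod int n')"
        using cong_trans[OF Y.R_add cong_scalar_right[OF Y.R_of_nat]] .
      \<comment> \<open>Both in-neighbours of \<open>?w\<close> are already located by
        \<open>IH\<close>. Which of their images keeps its index on the way to \<open>f ?w\<close>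
        fixes the sign at level \<open>k\<close>.\<close>
      have darts: "(f (X.pt (int k) j), f ?w) \<in> Y.darts"
        "(f (X.pt (int k) (j - X.R (int k))), f ?w) \<in> Y.darts"
        by (simp_all add: hom' X.darts_into_iff)
      have "X.pt (int k) j \<noteq> X.pt (int k) (j - X.R (int k))"
        using X.not_cong_R[of "int k"] by (simp add: X.pt_eq_iff cong_iff_dvd_diff)
      then have "Y.pt (int k + a) (?x j) \<noteq> Y.pt (int k + a) (?x (j - X.R (int k)))"
        using inj IH by metis
      with darts consider
          (minus) "[?x (j - X.R (int k)) = ?x j + Y.R (int k + a)] (mod int n')"
            "f ?w = Y.pt (int k + a + 1) (?x (j - X.R (int k)))"
        | (plus) "[?x j = ?x (j - X.R (int k)) + Y.R (int k + a)] (mod int n')"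
            "f ?w = Y.pt (int k + a + 1) (?x j)"
        using Y.common_out_neighbour[of "int k + a" "?x j" "f ?w" "?x (j - X.R (int k))"] IH by auto
      then show ?thesis
      proof cases
        case minus
        have "[Y.R a * (e * r ^ k) = Y.R a * (- (r' ^ k))] (mod int n')"
          by (rule cong_lincomb3[OF minus(1) R'k Rk, of _ _ "- 1" "- 1" "- Y.R a * e"])
            (simp add: algebra_simps)
        then have s: "[e * r ^ k = - (r' ^ k)] (mod int n')" by (simp only: Y.R_cancel)
        \<comment> \<open>Excluding the other sign selects the branch of \<open>drift\<close> that
          adds \<open>r' ^ k\<close>.\<close>
        have "\<not> [e * r ^ k = r' ^ k] (mod int n')"
        proof
          assume "[e * r ^ k = r' ^ k] (mod int n')"
          then have "[Y.R (int k) = - Y.R (int k)] (mod int n')"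
            using s Y.R_of_nat[of k] by (meson cong_sym cong_trans cong_uminus)
          with Y.not_cong_double_R show False ..
        qed
        then have "drift n' r r' e (Suc k) = drift n' r r' e k + r' ^ k" by (simp add: drift_def)
        moreover have "[?x (j - X.R (int k)) = ?x j + Y.R a * r' ^ k] (mod int n')"
          by (rule cong_lincomb2[OF minus(1) R'k, of _ _ 1 1]) (simp add: algebra_simps)
        ultimately have "Y.pt (int k + a + 1) (?x (j - X.R (int k))) =
            Y.pt (int k + a + 1) (Y.R a * (e * j + drift n' r r' e (Suc k)) + c)"
          by (simp add: Y.pt_eq_iff algebra_simps)
        with minus s show ?thesis by (simp add: algebra_simps)
      next
        case plus
        have "[Y.R a * (e * r ^ k) = Y.R a * (r' ^ k)] (mod int n')"
          by (rule cong_lincomb3[OF plus(1) R'k Rk, of _ _ 1 1 "- Y.R a * e"])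
            (simp add: algebra_simps)
        then have s: "[e * r ^ k = r' ^ k] (mod int n')" by (simp only: Y.R_cancel)
        then have "drift n' r r' e (Suc k) = drift n' r r' e k" by (simp add: drift_def)
        with plus s show ?thesis by (simp add: algebra_simps)
      qed
    qed
    show level: "\<forall>j. f (X.pt (int k) j) = Y.pt (int k + a) (Y.R a * (e * j + drift n' r r' e k) + c)"
    proof (induction k)
      case 0
      then show ?case using level0 by (simp add: drift_def)
    qed (use step in blast)
    show "[e * r ^ k = r' ^ k] (mod int n') \<or> [e * r ^ k = - (r' ^ k)] (mod int n')"
      using step[OF level] by blast
  qed
  \<comment> \<open>Both descriptions of this vertex have known images. Comparing their levels gives
    that \<open>m'\<close> divides \<open>m\<close>; comparing indices later gives the equation for
    \<open>t'\<close>.\<close>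
  have "X.pt (int m) 0 = X.pt 0 t" using X.pt_shift[of 0 1 0] by simp
  then have closing: "Y.pt a (Y.R a * (e * t) + c) = Y.pt (int m + a) (Y.R a * drift n' r r' e m + c)"
    using level[of m] level0[of t] by (metis add_0 mult_zero_right)
  then obtain q where "int m + a = a + int m' * q" by (rule Y.pt_eqD)
  then have "int m = int m' * q" by simp
  then have "int m' dvd int m" by (rule dvdI)
  then have "m' dvd m" by simp
  moreover have "n' dvd n" using n'_dvd by simp
  \<comment> \<open>Equal numbers of vertices turn the two divisibilities into equalities.\<close>
  moreover have "m * n = m' * n'"
    using f bij_betw_same_card[of f X.V Y.V] by (simp add: graph_isomorphism_def X.verts_Xe Y.verts_Xe)
  ultimately obtain p q where "m = m' * p" "n = n' * q" "m * n = m' * n'" unfolding dvd_def by blast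
  moreover from this have "p * q = 1" using X.m_pos Y.n_ge by simp
  ultimately have mn: "m' = m" "n' = n" by simp_all
  have "Y.pt (int m + a) (Y.R a * drift n' r r' e m + c) = Y.pt a (Y.R a * drift n' r r' e m + c + t')"
    using Y.pt_shift[of a 1] mn by (simp add: add.commute)
  with closing have "[Y.R a * (e * t) + c = Y.R a * drift n' r r' e m + c + t'] (mod int n')"
    using Y.pt_eq_iff by metis
  then have "[Y.R a * (drift n' r r' e m + t') = Y.R a * (e * t)] (mod int n')"
    by (rule cong_lincomb2[OF _ Y.R_t[of a], of _ _ _ _ "-1" 1]) (simp add: algebra_simps)
  then have "[drift n' r r' e m + t' = e * t] (mod int n')" by (simp only: Y.R_cancel)
  with e mn sign show thesis by (intro that) auto
qed

end

section \<open>From sign and drift to the parameters\<close>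

definition same_or_negated :: "nat \<Rightarrow> nat \<Rightarrow> int \<Rightarrow> int \<Rightarrow> int \<Rightarrow> int \<Rightarrow> bool" where
  "same_or_negated m n r t r' t' \<longleftrightarrow>
     [r' = r] (mod int n) \<and> [t' = t] (mod int n) \<or>
     [r' = - r] (mod int n) \<and> [t' = t + (\<Sum>k<m div 2. r ^ (2 * k + 1))] (mod int n)"

context Xe_graph begin

lemma not_cong_double_power: "\<not> [r ^ i = - (r ^ i)] (mod int n)"
proof
  assume "[r ^ i = - (r ^ i)] (mod int n)"
  then have "[R (int i) = - R (int i)] (mod int n)"
    using R_of_nat[of i] by (meson cong_sym cong_trans cong_uminus)
  with not_cong_double_R show False ..
qed

lemma not_cong_double_power': "\<not> [- (r ^ i) = r ^ i] (mod int n)"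
  using not_cong_double_power by (simp add: cong_sym_eq)

end

context Xe_same_size begin

text \<open>For \<open>e = 1\<close> no level contributes; for \<open>e = -1\<close> every level
  does.\<close>

lemma drift_same:
  assumes r': "[r' = r] (mod int n)"
  shows "drift n r r' 1 k = 0" "[drift n r r' (-1) k = (\<Sum>i<k. r ^ i)] (mod int n)"
proof -
  have pow: "[r ^ i = r' ^ i] (mod int n)" for i
    using cong_sym[OF r'] by (rule cong_pow)
  then show "drift n r r' 1 k = 0" by (simp add: drift_def)
  have "\<not> [- (r ^ i) = r' ^ i] (mod int n)" for i
    using X.not_cong_double_power'[of i] cong_trans[OF _ cong_sym[OF pow]] by metis
  moreover have "[r' ^ i = r ^ i] (mod int n)" for i
    using pow by (rule cong_sym)
  ultimately show "[drift n r r' (-1) k = (\<Sum>i<k. r ^ i)] (mod int n)"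
    unfolding drift_def by (intro cong_sum) simp
qed

text \<open>The signs alternate with the level: for \<open>e = 1\<close> exactly the odd levels
  contribute, for \<open>e = -1\<close> exactly the even ones.\<close>

lemma drift_negated:
  assumes r': "[r' = - r] (mod int n)"
  shows "[drift n r r' 1 (2 * k) = - (\<Sum>i<k. r ^ (2 * i + 1))] (mod int n)"
    and "[drift n r r' (-1) (2 * k) = (\<Sum>i<k. r ^ (2 * i))] (mod int n)"
proof -
  have even: "[r' ^ (2 * i) = r ^ (2 * i)] (mod int n)" for i
    using cong_pow[OF r', of "2 * i"] by simp
  have odd: "[r' ^ (2 * i + 1) = - (r ^ (2 * i + 1))] (mod int n)" for i
    using cong_pow[OF r', of "2 * i + 1"] by simp
  have even': "\<not> [- (r ^ (2 * i)) = r' ^ (2 * i)] (mod int n)" for i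
    using X.not_cong_double_power'[of "2 * i"] cong_trans[OF _ even] by metis
  have odd': "\<not> [r ^ (2 * i + 1) = r' ^ (2 * i + 1)] (mod int n)" for i
    using X.not_cong_double_power[of "2 * i + 1"] cong_trans[OF _ odd] by metis
  have "drift n r r' 1 (2 * k) = (\<Sum>i<k. r' ^ (2 * i + 1))"
    unfolding drift_def sum_even_odd using odd' cong_sym[OF even] by simp
  also have "[\<dots> = (\<Sum>i<k. - (r ^ (2 * i + 1)))] (mod int n)"
    using odd by (intro cong_sum)
  finally show "[drift n r r' 1 (2 * k) = - (\<Sum>i<k. r ^ (2 * i + 1))] (mod int n)"
    by (simp add: sum_negf)
  have "drift n r r' (-1) (2 * k) = (\<Sum>i<k. r' ^ (2 * i))"
    unfolding drift_def sum_even_odd using cong_sym[OF odd] even' by simp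
  also have "[\<dots> = (\<Sum>i<k. r ^ (2 * i))] (mod int n)"
    using even by (intro cong_sum)
  finally show "[drift n r r' (-1) (2 * k) = (\<Sum>i<k. r ^ (2 * i))] (mod int n)" .
qed

text \<open>The drift is known for each choice of \<open>e\<close> and of the sign relating
  \<open>r'\<close> to \<open>r\<close>. For \<open>e = -1\<close> the condition \<open>sum\<close>
  converts the result into the same value of \<open>t'\<close> as for \<open>e = 1\<close>.\<close>

lemma same_or_negated_if_drift:
  assumes m: "even m"
    and sum: "[(\<Sum>i<m. r ^ i) + 2 * t = 0] (mod int n)"
    and e: "e \<in> {1, -1}"
    and sign: "[e * r = r'] (mod int n) \<or> [e * r = - r'] (mod int n)"
    and closing: "[drift n r r' e m + t' = e * t] (mod int n)"
  shows "same_or_negated m n r t r' t'"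
proof -
  define S where "S = (\<Sum>k<m div 2. r ^ (2 * k + 1))"
  define E where "E = (\<Sum>k<m div 2. r ^ (2 * k))"
  have m2: "2 * (m div 2) = m" using m by simp
  have ES: "(\<Sum>i<m. r ^ i) = E + S"
    using sum_even_odd[of "\<lambda>i. r ^ i" "m div 2"] by (simp add: E_def S_def m2)
  consider "e = 1" "[r' = r] (mod int n)" | "e = -1" "[r' = r] (mod int n)"
    | "e = 1" "[r' = - r] (mod int n)" | "e = -1" "[r' = - r] (mod int n)"
  proof -
    have "[r' = r] (mod int n) \<or> [r' = - r] (mod int n)"
      using sign e cong_sym[of "e * r"] cong_sym[OF cong_uminus, of "e * r" "- r'"] by auto
    with e that show thesis by blast
  qed
  then show ?thesis
  proof cases
    case 1
    then show ?thesis using closing drift_same(1) by (simp add: same_or_negated_def)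
  next
    case 2
    have closing: "[drift n r r' (-1) m + t' = - 1 * t] (mod int n)"
      using closing by (simp only: 2(1))
    have "[t' = t] (mod int n)"
      by (rule cong_lincomb3[OF closing drift_same(2)[OF 2(2), of m] sum, of _ _ 1 "-1" "-1"]) simp
    with 2 show ?thesis by (simp add: same_or_negated_def)
  next
    case 3
    have closing: "[drift n r r' 1 m + t' = 1 * t] (mod int n)"
      using closing by (simp only: 3(1))
    have drift: "[drift n r r' 1 m = - S] (mod int n)"
      using drift_negated(1)[OF 3(2), of "m div 2"] by (simp only: m2 S_def)
    have "[t' = t + S] (mod int n)"
      by (rule cong_lincomb2[OF closing drift, of _ _ 1 "-1"]) simp
    with 3 show ?thesis by (simp add: same_or_negated_def S_def)
  next
    case 4
    have closing: "[drift n r r' (-1) m + t' = - 1 * t] (mod int n)"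
      using closing by (simp only: 4(1))
    have drift: "[drift n r r' (-1) m = E] (mod int n)"
      using drift_negated(2)[OF 4(2), of "m div 2"] by (simp only: m2 E_def)
    have "[t' = t + S] (mod int n)"
      by (rule cong_lincomb3[OF closing drift sum, of _ _ 1 "-1" "-1"]) (simp add: ES)
    with 4 show ?thesis by (simp add: same_or_negated_def S_def)
  qed
qed

text \<open>In the negated case the isomorphism fixes the levels, has slope 1 and uses the drift as
  translation. Over a full turn the drift is minus the sum of the odd powers, which is cancelled by
  the change from \<open>t\<close> to \<open>t'\<close>.\<close>

lemma isomorphic_if_same_or_negated:
  assumes m: "even m" and "same_or_negated m n r t r' t'"
  shows "Xe m n r t \<simeq>\<^sub>G Xe m n r' t'"
proof -
  from assms(2) consider
      (same) "[r' = r] (mod int n)" "[t' = t] (mod int n)"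
    | (negated) "[r' = - r] (mod int n)" "[t' = t + (\<Sum>k<m div 2. r ^ (2 * k + 1))] (mod int n)"
    by (auto simp: same_or_negated_def)
  then show ?thesis
  proof cases
    case same
    then have "Xe m n r' t' = Xe m n r t" by (rule Xe_cong)
    then have "graph_isomorphism (Xe m n r t) (Xe m n r' t') id"
      by (simp add: graph_isomorphism_def)
    then show ?thesis unfolding graph_isomorphic_def by blast
  next
    case negated
    let ?b = "drift n r r' 1"
    have R: "[X.R (int i) = r ^ i] (mod int n)" "[Y.R (int i) = r' ^ i] (mod int n)" for i
      by (rule X.R_of_nat Y.R_of_nat)+
    have pow: "[r' ^ i = (- r) ^ i] (mod int n)" for i
      using negated(1) by (rule cong_pow)
    have "[1 * X.R (int i) = Y.R (int i + 0)] (mod int n) \<and> [?b (Suc i) = ?b i] (mod int n) \<or>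
      [1 * X.R (int i) = - Y.R (int i + 0)] (mod int n) \<and>
      [?b (Suc i) = ?b i + Y.R (int i + 0)] (mod int n)" for i
    proof (cases "[r ^ i = r' ^ i] (mod int n)")
      case True
      then have "[X.R (int i) = Y.R (int i)] (mod int n)"
        using R by (meson cong_sym cong_trans)
      with True show ?thesis by (simp add: drift_def)
    next
      case False
      with pow[of i] have "odd i" by (auto simp: cong_sym_eq)
      with pow[of i] have "[r' ^ i = - (r ^ i)] (mod int n)" by simp
      then have "[- (r' ^ i) = r ^ i] (mod int n)" using cong_uminus by fastforce
      then have "[X.R (int i) = - Y.R (int i)] (mod int n)"
        using R cong_uminus[OF R(2)[of i]] by (meson cong_sym cong_trans)
      moreover have "[?b (Suc i) = ?b i + Y.R (int i)] (mod int n)"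
        using False cong_add[OF cong_refl[of "?b i"] cong_sym[OF R(2)[of i]]] by (simp add: drift_def)
      ultimately show ?thesis by simp
    qed
    moreover have "[?b m + t' = ?b 0 + 1 * t] (mod int n)"
      using drift_negated(1)[OF negated(1), of "m div 2"] negated(2)
      by (rule cong_lincomb2[of _ _ _ _ _ _ _ 1 1]) (use m in \<open>simp add: drift_def\<close>)
    ultimately show ?thesis
      using affine_isomorphism[of 1 0 ?b] unfolding graph_isomorphic_def by (metis coprime_1_left)
  qed
qed

end

section \<open>Inverse parameters and the classification\<close>

lemma Xe_graph_if_params: "Xe_params m n r t \<Longrightarrow> Xe_graph m n r t"
  by unfold_locales (auto simp: Xe_params_def)

lemma Xe_graph_inverse:
  assumes "Xe_graph m n r t" and inv: "[r * r' = 1] (mod int n)"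
  shows "Xe_graph m n r' t"
proof -
  interpret Xe_graph m n r t by fact
  show ?thesis
  proof
    show "coprime r' (int n)"
      using inv by (metis cong_imp_coprime cong_sym coprime_1_left coprime_mult_left_iff)
    have "[r ^ m * r' ^ m = 1] (mod int n)"
      using cong_pow[OF inv, of m] by (simp add: power_mult_distrib)
    then show "[r' ^ m = 1] (mod int n)"
      by (rule cong_lincomb2[OF _ r_pow_m, of _ _ _ _ 1 "- (r' ^ m)"]) (simp add: algebra_simps)
    show "[t * (r' - 1) = 0] (mod int n)"
      by (rule cong_lincomb2[OF tr inv, of _ _ "- r'" t]) (simp add: algebra_simps)
  qed (use m_pos n_ge in auto)
qed

lemma (in Xe_pair) dart_preserving_imp_same_or_negated:
  assumes "even m" "[(\<Sum>i<m. r ^ i) + 2 * t = 0] (mod int n)"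
    and "graph_isomorphism (Xe m n r t) (Xe m' n' r' t') f"
    and "\<forall>(u, v) \<in> X.darts. (f u, f v) \<in> Y.darts"
  shows "m' = m \<and> n' = n \<and> same_or_negated m n r t r' t'"
proof -
  obtain e where e: "e \<in> {1, -1}" "m' = m" "n' = n"
    "\<And>k :: nat. [e * r ^ k = r' ^ k] (mod int n) \<or> [e * r ^ k = - (r' ^ k)] (mod int n)"
    "[drift n r r' e m + t' = e * t] (mod int n)"
    using dart_preserving_isomorphism[OF assms(3,4)] by blast
  have "Xe_same_size m n r t r' t'"
    using X.Xe_graph_axioms Y.Xe_graph_axioms e(2,3) by (simp add: Xe_same_size_def)
  from Xe_same_size.same_or_negated_if_drift[OF this assms(1,2) e(1) _ e(5)] show ?thesis
    using e(2,3) e(4)[of 1] by simp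
qed

theorem proposition9p1:
  fixes m n m' n' :: nat and r t r' t' :: int
  assumes "Xe_params m n r t"
    and "half_arc_transitive (Xe m n r t)"
    and "Xe_params m' n' r' t'"
  shows "Xe m n r t \<simeq>\<^sub>G Xe m' n' r' t' \<longleftrightarrow>
    m' = m \<and> n' = n \<and>
    ([r' = r] (mod int n) \<and> [t' = t] (mod int n) \<or>
     [r' = - r] (mod int n) \<and> [t' = t + (\<Sum>k<m div 2. r ^ (2 * k + 1))] (mod int n) \<or>
     [r' = modular_inverse (int n) r] (mod int n) \<and> [t' = t] (mod int n) \<or>
     [r' = - modular_inverse (int n) r] (mod int n) \<and>
       [t' = t + (\<Sum>k<m div 2. r ^ (2 * k + 1))] (mod int n))"
proof -
  have params: "even m" "[(\<Sum>i<m. r ^ i) + 2 * t = 0] (mod int n)"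
      "[(\<Sum>i<m'. r' ^ i) + 2 * t' = 0] (mod int n')"
    using assms by (simp_all add: Xe_params_def)
  interpret X: Xe_graph m n r t by (rule Xe_graph_if_params) fact
  interpret Y: Xe_graph m' n' r' t' by (rule Xe_graph_if_params) fact
  interpret XY: Xe_pair m n m' n' r t r' t' ..
  \<comment> \<open>The graph with parameter \<open>q\<close> is the target with its orientation
    reversed.\<close>
  define q where "q = modular_inverse (int n') r'"
  have r'q: "[r' * q = 1] (mod int n')"
    unfolding q_def using Y.coprime_r by (rule cong_modular_inverse1)
  interpret Z: Xe_graph m' n' q t'
    using Y.Xe_graph_axioms r'q by (rule Xe_graph_inverse)
  interpret XZ: Xe_pair m n m' n' r t q t' ..
  interpret YZ: Xe_same_size m' n' r' t' q t' ..
  obtain g where g: "graph_isomorphism (Xe m' n' r' t') (Xe m' n' q t') g"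
    and g_rev: "\<And>u v. (u, v) \<in> Y.darts \<Longrightarrow> (g v, g u) \<in> Z.darts"
    using YZ.reversing_isomorphism[OF r'q cong_refl] by blast
  \<comment> \<open>With \<open>x\<close> equal to 1 or -1, the conditions on \<open>q\<close>
    become the two alternatives for \<open>r'\<close> that involve the inverse of
    \<open>r\<close>.\<close>
  have inverse_iff: "[q = x * r] (mod int n) \<longleftrightarrow> [r' = x * modular_inverse (int n) r] (mod int n)"
    if "n' = n" "x * x = 1" for x :: int
  proof -
    have rr: "[r * modular_inverse (int n) r = 1] (mod int n)"
      using X.coprime_r by (rule cong_modular_inverse1)
    then have rr': "[modular_inverse (int n) r * r = 1] (mod int n)" by (simp add: mult.commute)
    have "[r' * q = 1] (mod int n)" "[q * r' = 1] (mod int n)"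
      using r'q that by (simp_all add: mult.commute)
    with rr rr' that(2) cong_inverse_unique show ?thesis by blast
  qed
  have cases: "(m' = m \<and> n' = n \<and> (same_or_negated m n r t r' t' \<or> same_or_negated m n r t q t')) \<longleftrightarrow> 
    m' = m \<and> n' = n \<and>
    ([r' = r] (mod int n) \<and> [t' = t] (mod int n) \<or>
     [r' = - r] (mod int n) \<and> [t' = t + (\<Sum>k<m div 2. r ^ (2 * k + 1))] (mod int n) \<or>
     [r' = modular_inverse (int n) r] (mod int n) \<and> [t' = t] (mod int n) \<or>
     [r' = - modular_inverse (int n) r] (mod int n) \<and>
       [t' = t + (\<Sum>k<m div 2. r ^ (2 * k + 1))] (mod int n))"
    using inverse_iff[of 1] inverse_iff[of "-1"] by (auto simp: same_or_negated_def)
  show ?thesis unfolding cases[symmetric]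
  proof
    assume "Xe m n r t \<simeq>\<^sub>G Xe m' n' r' t'"
    then obtain f where f: "graph_isomorphism (Xe m n r t) (Xe m' n' r' t') f"
      unfolding graph_isomorphic_def ..
    have "\<not> arc_transitive (Xe m n r t)"
      using assms(2) by (simp add: half_arc_transitive_def)
    from XY.isomorphism_darts_cases[OF params(2,3) this f]
    show "m' = m \<and> n' = n \<and> (same_or_negated m n r t r' t' \<or> same_or_negated m n r t q t')"
    proof
      assume "\<forall>(u, v) \<in> X.darts. (f u, f v) \<in> Y.darts"
      then show ?thesis
        using XY.dart_preserving_imp_same_or_negated[OF params(1,2) f] by blast
    next
      assume "\<forall>(u, v) \<in> X.darts. (f v, f u) \<in> Y.darts"
      \<comment> \<open>Two reversals compose to an orientation preserving isomorphism onto the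
        graph with parameter \<open>q\<close>.\<close>
      then have "\<forall>(u, v) \<in> X.darts. ((g \<circ> f) u, (g \<circ> f) v) \<in> Z.darts"
        by (auto intro!: g_rev)
      then show ?thesis
        using XZ.dart_preserving_imp_same_or_negated[OF params(1,2) graph_isomorphism_comp[OF f g]]
        by blast
    qed
  next
    assume *: "m' = m \<and> n' = n \<and> (same_or_negated m n r t r' t' \<or> same_or_negated m n r t q t')"
    then have mn: "m' = m" "n' = n" by simp_all
    have "Xe_same_size m n r t r' t'" "Xe_same_size m n r t q t'"
      using X.Xe_graph_axioms Y.Xe_graph_axioms Z.Xe_graph_axioms mn by (simp_all add: Xe_same_size_def)
    with * have "Xe m n r t \<simeq>\<^sub>G Xe m' n' r' t' \<or> Xe m n r t \<simeq>\<^sub>G Xe m' n' q t'"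
      using Xe_same_size.isomorphic_if_same_or_negated params(1) mn by blast
    moreover have "Xe m' n' q t' \<simeq>\<^sub>G Xe m' n' r' t'"
      using g graph_isomorphic_sym unfolding graph_isomorphic_def by blast
    ultimately show "Xe m n r t \<simeq>\<^sub>G Xe m' n' r' t'"
      using graph_isomorphic_trans by blast
  qed
qed

end
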